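(* The core-minus order $\overset{\mathtt{CM}}{\le}$ is a partial order on $\mathbb{C}_{n,n}$ (reflexive, transitive and antisymmetric).
   Context: $\mathbb{C}_{n,n}$ is the set of $n\times n$ complex matrices, $A^\ast$ is the conjugate transpose, $\mathrm{rk}$ the rank, $\mathcal{R}(A)$ the column space, $A^\dag$ the Moore-Penrose inverse. The index $\mathrm{Ind}(A)$ is $0$ if $A$ is non-singular, and otherwise is the smallest positive integer $k$ with $\mathrm{rk}(A^{k+1})=\mathrm{rk}(A^k)$. $\mathbb{C}_n^{\mathtt{CM}}=\{A\in\mathbb{C}_{n,n} : \mathrm{rk}(A^2)=\mathrm{rk}(A)\}$ (core-invertible matrices). Core-EP decomposition: for $A\in\mathbb{C}_{n,n}$ with $\mathrm{Ind}(A)=k$, it is the (existing and unique) decomposition $A=A_1+A_2$ with $A_1\in\mathbb{C}_n^{\mathtt{CM}}$, $A_2^k=0$ (read as $A_2=0$ when $k=0$), and $A_1^\ast A_2=A_2A_1=0$. Core inverse: for $A\in\mathbb{C}_n^{\mathtt{CM}}$, $A^{(\#)}$ is the unique $X\in\mathbb{C}_{n,n}$ with $AX=AA^\dag$ and $\mathcal{R}(X)\subseteq\mathcal{R}(A)$. Core partial order: for $A,B\in\mathbb{C}_n^{\mathtt{CM}}$, $A\overset{(\#)}{\le}B$ means $A^{(\#)}A=A^{(\#)}B$ and $AA^{(\#)}=BA^{(\#)}$. Minus partial order: $A\overset{-}{\le}B$ means $\mathrm{rk}(B)-\mathrm{rk}(A)=\mathrm{rk}(B-A)$. Core-minus order: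 for $A,B\in\mathbb{C}_{n,n}$ with core-EP decompositions $A=A_1+A_2$ and $B=B_1+B_2$ ($A_1,B_1$ core-invertible, $A_2,B_2$ nilpotent), $A\overset{\mathtt{CM}}{\le}B$ means $A_1\overset{(\#)}{\le}B_1$ and $A_2\overset{-}{\le}B_2$. *)

theory Defs
  imports "HOL-Analysis.Analysis"
begin

text \<open>
  The \<open>n \<times> n\<close> complex matrices are \<^typ>\<open>complex^'n^'n\<close>. On this type \<open>*\<close>, \<open>^\<close> and \<open>\<le>\<close>
  are the componentwise operations; the matrix product is \<open>**\<close> and matrix powers are
  \<open>mat_pow\<close> below. The library's \<open>rank\<close> is the dimension of the row space over the
  base field, here the complex numbers; likewise \<open>vec.span\<close> is the complex span.
\<close>

definition mat_pow :: "complex^'n^'n \<Rightarrow> nat \<Rightarrow> complex^'n^'n" where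
  "mat_pow A k = (((**) A) ^^ k) (mat 1)"

definition conj_transpose :: "complex^'n^'m \<Rightarrow> complex^'m^'n" where
  "conj_transpose A = map_matrix cnj (transpose A)"

definition col_space :: "complex^'n^'m \<Rightarrow> (complex^'m) set" where
  "col_space A = vec.span (columns A)"

text \<open>The Moore-Penrose inverse, as the unique solution of the four Penrose equations.\<close>

definition mp_inverse :: "complex^'n^'m \<Rightarrow> complex^'m^'n" where
  "mp_inverse A = (THE X.
     A ** X ** A = A \<and> X ** A ** X = X \<and>
     conj_transpose (A ** X) = A ** X \<and> conj_transpose (X ** A) = X ** A)"

definition mat_index :: "complex^'n^'n \<Rightarrow> nat" where
  "mat_index A =
     (if invertible A then 0
      else (LEAST k. 0 < k \<and> rank (mat_pow A (k + 1)) = rank (mat_pow A k)))"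

definition core_invertible :: "(complex^'n^'n) set" where
  "core_invertible = {A. rank (mat_pow A 2) = rank A}"

text \<open>
  For \<open>k = 0\<close> the condition \<open>A2\<^sup>k = 0\<close> is read as \<open>A2 = 0\<close>, since literally it would say
  that the identity matrix is zero.
\<close>

definition core_EP_decomp :: "complex^'n^'n \<Rightarrow> complex^'n^'n \<Rightarrow> complex^'n^'n \<Rightarrow> bool" where
  "core_EP_decomp A A1 A2 \<longleftrightarrow>
     A = A1 + A2 \<and>
     A1 \<in> core_invertible \<and>
     (if mat_index A = 0 then A2 = 0 else mat_pow A2 (mat_index A) = 0) \<and>
     conj_transpose A1 ** A2 = 0 \<and>
     A2 ** A1 = 0"

text \<open>Only meaningful for core-invertible \<open>A\<close>, where such an \<open>X\<close> exists and is unique.\<close>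

definition core_inverse :: "complex^'n^'n \<Rightarrow> complex^'n^'n" where
  "core_inverse A = (THE X. A ** X = A ** mp_inverse A \<and> col_space X \<subseteq> col_space A)"

definition core_le :: "complex^'n^'n \<Rightarrow> complex^'n^'n \<Rightarrow> bool" where
  "core_le A B \<longleftrightarrow>
     A \<in> core_invertible \<and> B \<in> core_invertible \<and>
     core_inverse A ** A = core_inverse A ** B \<and>
     A ** core_inverse A = B ** core_inverse A"

definition minus_le :: "complex^'n^'n \<Rightarrow> complex^'n^'n \<Rightarrow> bool" where
  "minus_le A B \<longleftrightarrow> int (rank B) - int (rank A) = int (rank (B - A))"

text \<open>
  Since core-EP decompositions exist and are unique, the existential quantifiers
  merely name the components of the decompositions of \<open>A\<close> and \<open>B\<close>.
\<close>

definition core_minus_le :: "complex^'n^'n \<Rightarrow> complex^'n^'n \<Rightarrow> bool" where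
  "core_minus_le A B \<longleftrightarrow>
     (\<exists>A1 A2 B1 B2. core_EP_decomp A A1 A2 \<and> core_EP_decomp B B1 B2 \<and>
        core_le A1 B1 \<and> minus_le A2 B2)"

end

theory Submission
  imports Defs
begin

text \<open>
  Between core-invertible matrices, \<open>A\<close> lies below \<open>B\<close> in the core order iff
  \<open>A\<^sup>* A = A\<^sup>* B\<close> and \<open>A\<^sup>2 = B A\<close>; in this form, and with the inclusion of column spaces
  that it entails, transitivity and antisymmetry are short computations with matrix products.
  The minus order inherits both properties from subadditivity of the rank. For the core-EP
  decomposition, let \<open>P\<close> be the orthogonal projector onto the column space of \<open>A\<^sup>k\<close>: then
  \<open>P A + (A - P A)\<close> is a decomposition. Conversely the core-invertible part \<open>A1\<close> of
  any decomposition has the column space of \<open>A\<^sup>k\<close> and satisfies \<open>A1\<^sup>* (A - A1) = 0\<close>,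
  which pins it down.
\<close>

section \<open>Rank over a field\<close>

lemma matrix_sub_ldistrib: "A ** (B - C) = A ** B - A ** (C :: 'a::ring_1^'n^'m)"
  by (simp add: matrix_matrix_mult_def vec_eq_iff right_diff_distrib sum_subtractf)

lemma matrix_sub_rdistrib: "(A - B) ** C = A ** C - B ** (C :: 'a::ring_1^'n^'m)"
  by (simp add: matrix_matrix_mult_def vec_eq_iff left_diff_distrib sum_subtractf)

lemma matrix_add_rdistrib: "(A + B) ** C = A ** C + B ** (C :: 'a::semiring_1^'n^'m)"
  by (simp add: matrix_matrix_mult_def vec_eq_iff distrib_right sum.distrib)

lemma row_matrix_mult: "row i (A ** B) = (\<Sum>k\<in>UNIV. A $ i $ k *s row k B)"
  by (simp add: row_def matrix_matrix_mult_def vec_eq_iff)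

lemma row_in_span_rows: "row k B \<in> vec.span (rows B)" for B :: "'a::field^'n^'m"
  by (rule vec.span_base) (auto simp: rows_def)

lemma rows_matrix_mult_subset:
  fixes A :: "'a::field^'n^'m"
  shows "rows (A ** B) \<subseteq> vec.span (rows B)"
  unfolding rows_def[of "A ** B"]
  by (auto simp: row_matrix_mult intro!: vec.span_sum vec.span_scale row_in_span_rows)

lemma rank_matrix_mult_le_right:
  fixes A :: "'a::field^'n^'m"
  shows "rank (A ** B) \<le> rank B"
  unfolding row_rank_def_gen by (rule vec.dim_mono) (rule rows_matrix_mult_subset)

lemma in_span_rows_iff:
  fixes B :: "'a::field^'n^'m"
  shows "v \<in> vec.span (rows B) \<longleftrightarrow> (\<exists>c. v = (\<Sum>k\<in>UNIV. c k *s row k B))"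
proof
  have "rows B = range (\<lambda>k. row k B)"
    by (auto simp: rows_def)
  moreover assume "v \<in> vec.span (rows B)"
  ultimately have "v \<in> vec.span (range (\<lambda>k. row k B))"
    by simp
  then show "\<exists>c. v = (\<Sum>k\<in>UNIV. c k *s row k B)"
  proof (induction rule: vec.span_induct_alt)
    case base
    show ?case
      by (rule exI[of _ "\<lambda>_. 0"]) simp
  next
    case (step a x y)
    then obtain j c where "x = row j B" "y = (\<Sum>k\<in>UNIV. c k *s row k B)"
      by blast
    then have "a *s x + y = (\<Sum>k\<in>UNIV. ((if k = j then a else 0) + c k) *s row k B)"
      by (simp add: vec.scale_left_distrib sum.distrib if_distrib[of "\<lambda>t. t *s _"] cong: if_cong)
    then show ?case
      by (intro exI[of _ "\<lambda>k. (if k = j then a else 0) + c k"])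
  qed
next
  assume "\<exists>c. v = (\<Sum>k\<in>UNIV. c k *s row k B)"
  then show "v \<in> vec.span (rows B)"
    by (auto intro!: vec.span_sum vec.span_scale row_in_span_rows)
qed

lemma row_space_subset_imp_left_multiple:
  fixes A :: "'a::field^'n^'m" and B :: "'a^'n^'l"
  assumes "rows A \<subseteq> vec.span (rows B)"
  obtains Z where "A = Z ** B"
proof -
  have "\<exists>c. row i A = (\<Sum>k\<in>UNIV. c k *s row k B)" for i
    using assms by (auto simp: rows_def simp flip: in_span_rows_iff)
  then obtain c where c: "\<And>i. row i A = (\<Sum>k\<in>UNIV. c i k *s row k B)"
    by metis
  have "row i A = row i ((\<chi> i k. c i k) ** B)" for i
    by (simp add: row_matrix_mult c)
  then have "A = (\<chi> i k. c i k) ** B"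
    by (simp add: row_def vec_eq_iff)
  then show thesis
    by (rule that)
qed

text \<open>Left multiplication by \<open>A\<close> can only shrink the row space of
  \<open>B\<close>, so equal rank forces equal row spaces, and then \<open>B\<close> is a left
  multiple of the product. This turns rank conditions into equations between products.\<close>

lemma rank_matrix_mult_eq_right_iff:
  fixes A :: "'a::field^'n^'m"
  shows "rank (A ** B) = rank B \<longleftrightarrow> (\<exists>Z. B = Z ** (A ** B))"
proof
  assume "rank (A ** B) = rank B"
  then have "vec.span (rows (A ** B)) = vec.span (rows B)"
    using rows_matrix_mult_subset[of A B] unfolding row_rank_def_gen
    by (intro vec.subspace_dim_equal) (auto simp: vec.span_minimal)
  then show "\<exists>Z. B = Z ** (A ** B)"
    by (metis row_space_subset_imp_left_multiple vec.span_superset)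
next
  assume "\<exists>Z. B = Z ** (A ** B)"
  then show "rank (A ** B) = rank B"
    by (metis order_antisym rank_matrix_mult_le_right)
qed

text \<open>The row space of a sum lies in the sum of the two row spaces.\<close>

lemma rank_plus_le:
  fixes A B :: "'a::field^'n^'m"
  shows "rank (A + B) \<le> rank A + rank B"
proof -
  let ?S = "{x + y |x y. x \<in> vec.span (rows A) \<and> y \<in> vec.span (rows B)}"
  have "row i (A + B) = row i A + row i B" for i
    by (simp add: row_def vec_eq_iff)
  then have "rows (A + B) \<subseteq> ?S"
    unfolding rows_def[of "A + B"] by auto (metis row_in_span_rows)
  then have "rank (A + B) \<le> vec.dim ?S"
    unfolding row_rank_def_gen by (rule vec.dim_subset)
  also have "\<dots> \<le> rank A + rank B"
    using vec.dim_sums_Int[OF vec.subspace_span vec.subspace_span, of "rows A" "rows B"]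
    unfolding row_rank_def_gen vec.dim_span by linarith
  finally show ?thesis .
qed

lemma rank_eq_0_imp_zero:
  fixes A :: "'a::field^'n^'m"
  assumes "rank A = 0"
  shows "A = 0"
proof -
  have "row i A = 0" for i
    using assms by (auto simp: row_rank_def_gen rows_def)
  then show ?thesis
    by (simp add: row_def vec_eq_iff)
qed

lemma rank_zero: "rank (0 :: 'a::field^'n^'m) = 0"
  by (auto simp: row_rank_def_gen rows_def row_def vec_eq_iff)

section \<open>Column spaces\<close>

lemma column_eq_mult_axis:
  fixes A :: "'a::comm_semiring_1^'n^'m"
  shows "column j A = A *v axis j 1"
  by (simp add: vec_eq_iff matrix_vector_mult_def column_def axis_def if_distrib[of "(*) _"] cong: if_cong)

lemma span_columns_eq_range:
  fixes A :: "'a::field^'n^'m"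
  shows "vec.span (columns A) = range ((*v) A)"
proof
  have "columns A \<subseteq> range ((*v) A)"
    by (auto simp: columns_def column_eq_mult_axis)
  moreover have "vec.subspace (range ((*v) A))"
    by (rule vec.linear_subspace_image) auto
  ultimately show "vec.span (columns A) \<subseteq> range ((*v) A)"
    by (rule vec.span_minimal)
qed (auto simp: matrix_vector_mult_in_columnspace_gen)

lemma range_subset_imp_right_multiple:
  fixes A :: "'a::field^'n^'m" and B :: "'a^'l^'m"
  assumes "range ((*v) A) \<subseteq> range ((*v) B)"
  obtains W where "A = B ** W"
proof -
  have "\<exists>x. B *v x = A *v axis j 1" for j
    using subsetD[OF assms rangeI[of _ "axis j 1"]] by (metis rangeE)
  then obtain w where w: "\<And>j. B *v w j = A *v axis j 1"
    by metis
  have "column j A = column j (B ** (\<chi> i j. w j $ i))" for j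
  proof -
    have "column j (B ** (\<chi> i j. w j $ i)) = B *v w j"
      by (simp add: column_def matrix_matrix_mult_def matrix_vector_mult_def vec_eq_iff)
    then show ?thesis
      by (simp only: w column_eq_mult_axis[of j A])
  qed
  then have "A = B ** (\<chi> i j. w j $ i)"
    by (simp add: column_def vec_eq_iff)
  then show thesis
    by (rule that)
qed

lemma col_space_subset_iff: "col_space A \<subseteq> col_space B \<longleftrightarrow> (\<exists>W. A = B ** W)"
  unfolding col_space_def span_columns_eq_range
proof
  assume "range ((*v) A) \<subseteq> range ((*v) B)"
  then show "\<exists>W. A = B ** W"
    by (rule range_subset_imp_right_multiple) (rule exI)
qed (auto simp flip: matrix_vector_mul_assoc)

text \<open>\<open>A\<close> maps the column space of \<open>B\<close> into itself; being injective there, it is also onto.\<close>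

lemma rank_preserved_imp_right_multiple:
  fixes A :: "'a::field^'m^'m" and B :: "'a^'n^'m"
  assumes "rank (A ** B) = rank B" and "A ** B = B ** C"
  obtains W where "B = A ** B ** W"
proof -
  obtain Z where Z: "B = Z ** (A ** B)"
    using assms(1) unfolding rank_matrix_mult_eq_right_iff ..
  have sub: "vec.subspace (range ((*v) M))" for M :: "'a^'n^'m"
    by (rule vec.linear_subspace_image) auto
  have AB: "range ((*v) (A ** B)) = (*v) A ` range ((*v) B)"
    by (auto simp: image_image simp flip: matrix_vector_mul_assoc)
  have "inj_on ((*v) A) (range ((*v) B))"
  proof (rule inj_onI)
    fix x y
    assume "x \<in> range ((*v) B)" "y \<in> range ((*v) B)" and eq: "A *v x = A *v y"
    then obtain u v where uv: "x = B *v u" "y = B *v v"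
      by blast
    then have "Z *v (A *v (B *v u)) = Z *v (A *v (B *v v))"
      using eq by simp
    then show "x = y"
      using Z uv by (simp add: matrix_vector_mul_assoc matrix_mul_assoc)
  qed
  then have "vec.dim (range ((*v) (A ** B))) = vec.dim (range ((*v) B))"
    unfolding AB by (intro vec.dim_image_eq) (auto simp: vec.span_eq_iff[THEN iffD2, OF sub])
  moreover have "range ((*v) (A ** B)) \<subseteq> range ((*v) B)"
    unfolding assms(2) by (auto simp flip: matrix_vector_mul_assoc)
  ultimately have "range ((*v) (A ** B)) = range ((*v) B)"
    using sub by (intro vec.subspace_dim_equal) auto
  then have "range ((*v) B) \<subseteq> range ((*v) (A ** B))"
    by simp
  then show thesis
    by (rule range_subset_imp_right_multiple) (rule that)
qed

text \<open>A linear map has a linear right inverse on its range; the matrix of that inverse serves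
  as \<open>G\<close>.\<close>

lemma inner_inverse_exists:
  fixes A :: "'a::field^'n^'m"
  obtains G where "A ** G ** A = A"
proof -
  obtain g where g: "Vector_Spaces.linear (*s) (*s) g" "\<And>v. v \<in> range ((*v) A) \<Longrightarrow> A *v g v = v"
    using vec.linear_exists_right_inverse_on[OF matrix_vector_mul_linear_gen vec.subspace_UNIV, of A]
    by blast
  have "A ** matrix g ** A = A"
    using g by (simp add: matrix_eq matrix_works[OF g(1)] flip: matrix_vector_mul_assoc)
  then show thesis
    by (rule that)
qed

section \<open>Moore-Penrose and core inverses\<close>

lemma conj_transpose_conj_transpose [simp]: "conj_transpose (conj_transpose A) = A"
  by (simp add: conj_transpose_def transpose_def vec_eq_iff)

lemma conj_transpose_mult: "conj_transpose (A ** B) = conj_transpose B ** conj_transpose A"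
  by (simp add: conj_transpose_def transpose_def matrix_matrix_mult_def vec_eq_iff mult.commute)

lemma conj_transpose_diff: "conj_transpose (A - B) = conj_transpose A - conj_transpose B"
  by (simp add: conj_transpose_def transpose_def vec_eq_iff)

text \<open>The diagonal entries of \<open>A\<^sup>* A\<close> are the squared norms of the columns
  of \<open>A\<close>.\<close>

lemma conj_transpose_mult_self_eq_zero:
  assumes "conj_transpose A ** A = 0"
  shows "A = 0"
proof -
  have "A $ k $ i = 0" for k i
  proof -
    have "(\<Sum>k\<in>UNIV. cnj (A $ k $ i) * A $ k $ i) = (conj_transpose A ** A) $ i $ i"
      by (simp add: conj_transpose_def transpose_def matrix_matrix_mult_def)
    also have "\<dots> = 0"
      using assms by simp
    finally have "complex_of_real (\<Sum>k\<in>UNIV. (cmod (A $ k $ i))\<^sup>2) = 0"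
      by (simp add: complex_norm_square mult.commute del: of_real_power)
    then have "(\<Sum>k\<in>UNIV. (cmod (A $ k $ i))\<^sup>2) = 0"
      by (simp only: of_real_eq_0_iff)
    then show ?thesis
      by (simp add: sum_nonneg_eq_0_iff)
  qed
  then show ?thesis
    by (simp add: vec_eq_iff)
qed

text \<open>With an inner inverse \<open>G\<close> of \<open>A\<^sup>* A\<close>, the matrix
  \<open>G\<^sup>* A\<^sup>*\<close> is a least-squares inverse \<open>X\<close>: the product
  \<open>A ** X\<close> is the orthogonal projector onto the column space of
  \<open>A\<close>.\<close>

lemma hermitian_inner_inverse_exists:
  fixes A :: "complex^'n^'m"
  obtains X where "A ** X ** A = A" "conj_transpose (A ** X) = A ** X"
proof -
  let ?H = "conj_transpose A"
  obtain G where G: "?H ** A ** G ** (?H ** A) = ?H ** A"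
    by (rule inner_inverse_exists)
  \<comment> \<open>Since \<open>?H ** A ** ?E\<close> vanishes, \<open>A ** ?E\<close> is
    orthogonal to itself, hence zero; this cancels the left factor \<open>?H\<close> from the
    equation for \<open>G\<close>.\<close>
  let ?E = "G ** (?H ** A) - mat 1"
  have "conj_transpose (A ** ?E) ** (A ** ?E) = conj_transpose ?E ** (?H ** A ** ?E)"
    by (simp only: conj_transpose_mult matrix_mul_assoc)
  also have "?H ** A ** ?E = ?H ** A ** G ** (?H ** A) - ?H ** A"
    by (simp add: matrix_sub_ldistrib matrix_mul_assoc)
  finally have "conj_transpose (A ** ?E) ** (A ** ?E) =
      conj_transpose ?E ** (?H ** A ** G ** (?H ** A) - ?H ** A)" .
  then have "conj_transpose (A ** ?E) ** (A ** ?E) = 0"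
    by (simp only: G diff_self times0_right)
  then have "A ** ?E = 0"
    by (rule conj_transpose_mult_self_eq_zero)
  then have "A ** G ** ?H ** A = A"
    by (simp add: matrix_sub_ldistrib matrix_mul_assoc)
  define X where "X = conj_transpose G ** ?H"
  have H: "?H ** (A ** X) = ?H"
    using arg_cong[OF \<open>A ** G ** ?H ** A = A\<close>, of conj_transpose]
    by (simp only: X_def conj_transpose_mult conj_transpose_conj_transpose)
  \<comment> \<open>A product of the form \<open>M\<^sup>* M\<close> is Hermitian, so this equation
    makes \<open>A ** X\<close> Hermitian.\<close>
  have P: "conj_transpose (A ** X) ** (A ** X) = conj_transpose (A ** X)"
    by (simp only: conj_transpose_mult H flip: matrix_mul_assoc)
  have "A ** X = conj_transpose (conj_transpose (A ** X) ** (A ** X))"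
    unfolding P by simp
  also have "\<dots> = conj_transpose (A ** X)"
    by (subst conj_transpose_mult) (simp only: conj_transpose_conj_transpose P)
  finally have herm: "conj_transpose (A ** X) = A ** X" ..
  have "A ** X ** A = conj_transpose (?H ** (A ** X))"
    by (simp only: conj_transpose_mult[of ?H] herm conj_transpose_conj_transpose)
  also have "\<dots> = A"
    by (simp only: H conj_transpose_conj_transpose)
  finally show thesis
    using herm by (rule that)
qed

text \<open>\<open>A ** X\<close> and \<open>A ** Y\<close> are Hermitian idempotents with the same
  column space, hence equal; \<open>X ** A\<close> and \<open>Y ** A\<close> agree likewise, and the
  second Penrose equation recovers \<open>X\<close> and \<open>Y\<close> from these
  products.\<close>

lemma mp_inverse_unique:
  assumes "A ** X ** A = A" "X ** A ** X = X"
    "conj_transpose (A ** X) = A ** X" "conj_transpose (X ** A) = X ** A"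
  assumes "A ** Y ** A = A" "Y ** A ** Y = Y"
    "conj_transpose (A ** Y) = A ** Y" "conj_transpose (Y ** A) = Y ** A"
  shows "X = Y"
proof -
  have "A ** X = conj_transpose ((A ** Y) ** (A ** X))"
    using assms by (simp add: matrix_mul_assoc)
  also have "\<dots> = (A ** X) ** (A ** Y)"
    using assms by (simp only: conj_transpose_mult[of "A ** Y" "A ** X"])
  also have "\<dots> = A ** Y"
    using assms by (simp add: matrix_mul_assoc)
  finally have AX: "A ** X = A ** Y" .
  have "X ** A = conj_transpose ((X ** A) ** (Y ** A))"
    using assms by (simp flip: matrix_mul_assoc)
  also have "\<dots> = (Y ** A) ** (X ** A)"
    using assms by (simp only: conj_transpose_mult[of "X ** A" "Y ** A"])
  also have "\<dots> = Y ** A"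
    using assms by (simp flip: matrix_mul_assoc)
  finally have XA: "X ** A = Y ** A" .
  have "X = X ** (A ** X)"
    using assms by (simp add: matrix_mul_assoc)
  also have "\<dots> = Y ** A ** Y"
    unfolding AX by (simp only: matrix_mul_assoc XA)
  finally show ?thesis
    using assms by simp
qed

text \<open>Let \<open>X\<close> be an inner inverse with \<open>A ** X\<close> Hermitian and
  \<open>?Y\<close> one with \<open>?Y ** A\<close> Hermitian, the latter obtained by passing to
  \<open>A\<^sup>*\<close>. Then \<open>?Y ** A ** X\<close> satisfies all four Penrose
  equations.\<close>

lemma mp_inverse:
  shows mult_mp_inverse_mult: "A ** mp_inverse A ** A = A"
    and hermitian_mult_mp_inverse: "conj_transpose (A ** mp_inverse A) = A ** mp_inverse A"
proof -
  let ?P = "\<lambda>X. A ** X ** A = A \<and> X ** A ** X = X \<and>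
     conj_transpose (A ** X) = A ** X \<and> conj_transpose (X ** A) = X ** A"
  obtain X where X: "A ** X ** A = A" "conj_transpose (A ** X) = A ** X"
    by (rule hermitian_inner_inverse_exists)
  obtain Y where Y: "conj_transpose A ** Y ** conj_transpose A = conj_transpose A"
    "conj_transpose (conj_transpose A ** Y) = conj_transpose A ** Y"
    by (rule hermitian_inner_inverse_exists)
  let ?Y = "conj_transpose Y"
  have Y': "A ** ?Y ** A = A" "conj_transpose (?Y ** A) = ?Y ** A"
    using arg_cong[OF Y(1), of conj_transpose] Y(2)
    by (simp_all add: conj_transpose_mult matrix_mul_assoc)
  let ?M = "?Y ** A ** X"
  have AM: "A ** ?M = A ** X"
    by (simp add: matrix_mul_assoc Y'(1))
  have MA: "?M ** A = ?Y ** A"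
    using X(1) by (simp flip: matrix_mul_assoc)
  have "?M ** A ** ?M = ?M ** (A ** ?M)"
    by (simp only: matrix_mul_assoc)
  also have "\<dots> = ?M ** A ** X"
    unfolding AM by (simp only: matrix_mul_assoc)
  also have "\<dots> = ?M"
    unfolding MA ..
  finally have "?P ?M"
    by (simp only: AM MA X Y' simp_thms)
  moreover from this have "X = ?M" if "?P X" for X
    using that by (elim conjE) (rule mp_inverse_unique)
  ultimately have "?P (mp_inverse A)"
    unfolding mp_inverse_def by (rule theI)
  then show "A ** mp_inverse A ** A = A" "conj_transpose (A ** mp_inverse A) = A ** mp_inverse A"
    by blast+
qed

section \<open>Matrix powers and core-invertible matrices\<close>

lemma mat_pow_0 [simp]: "mat_pow A 0 = mat 1"
  by (simp add: mat_pow_def)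

lemma mat_pow_Suc: "mat_pow A (Suc k) = A ** mat_pow A k"
  by (simp add: mat_pow_def)

lemma mat_pow_Suc_right: "mat_pow A (Suc k) = mat_pow A k ** A"
  by (induction k) (simp_all add: mat_pow_Suc matrix_mul_assoc)

lemma core_invertible_rank_iff: "A \<in> core_invertible \<longleftrightarrow> rank (A ** A) = rank A"
  by (simp add: core_invertible_def numeral_2_eq_2 mat_pow_Suc)

lemma core_invertible_left_iff: "A \<in> core_invertible \<longleftrightarrow> (\<exists>Z. A = Z ** (A ** A))"
  unfolding core_invertible_rank_iff by (rule rank_matrix_mult_eq_right_iff)

lemma core_invertible_right:
  assumes "A \<in> core_invertible"
  obtains W where "A = A ** A ** W"
  using assms unfolding core_invertible_rank_iff
  by (rule rank_preserved_imp_right_multiple) (rule refl, rule that)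

text \<open>From \<open>A = Z ** (A ** A)\<close>, the matrices \<open>A\<close> and
  \<open>A ** A\<close> have the same null space.\<close>

lemma core_invertible_left_cancel:
  assumes "A \<in> core_invertible" and "A ** (A ** U) = A ** (A ** V)"
  shows "A ** U = A ** V"
proof -
  obtain Z where Z: "A = Z ** (A ** A)"
    using assms(1) unfolding core_invertible_left_iff ..
  have "A ** U = Z ** (A ** A) ** U"
    by (simp only: Z[symmetric])
  also have "\<dots> = Z ** (A ** (A ** U))"
    by (simp only: matrix_mul_assoc)
  also have "\<dots> = Z ** (A ** A) ** V"
    unfolding assms(2) by (simp only: matrix_mul_assoc)
  finally show ?thesis
    by (simp only: Z[symmetric])
qed

text \<open>With \<open>A = A ** A ** W\<close>, the matrix \<open>A ** (W ** mp_inverse A)\<close>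
  meets both defining conditions, and left cancellation on right multiples of \<open>A\<close> makes
  it the only one.\<close>

lemma core_inverse:
  assumes "A \<in> core_invertible"
  shows mult_core_inverse: "A ** core_inverse A = A ** mp_inverse A"
    and core_inverse_right_multiple: "\<exists>U. core_inverse A = A ** U"
proof -
  obtain W where W: "A = A ** A ** W"
    using assms by (rule core_invertible_right)
  have AAW: "A ** (A ** (W ** mp_inverse A)) = A ** mp_inverse A"
    by (simp only: matrix_mul_assoc W[symmetric])
  let ?P = "\<lambda>X. A ** X = A ** mp_inverse A \<and> (\<exists>U. X = A ** U)"
  have "?P (THE X. ?P X)"
  proof (rule theI[of ?P "A ** (W ** mp_inverse A)"])
    show "?P (A ** (W ** mp_inverse A))"
      by (intro conjI exI) (rule AAW, rule refl)
  next
    fix X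
    assume "?P X"
    then obtain V where X: "A ** X = A ** mp_inverse A" and V: "X = A ** V"
      by (elim conjE exE)
    show "X = A ** (W ** mp_inverse A)"
      unfolding V by (rule core_invertible_left_cancel[OF assms]) (simp only: X[unfolded V] AAW)
  qed
  then have "?P (core_inverse A)"
    unfolding core_inverse_def col_space_subset_iff .
  then show "A ** core_inverse A = A ** mp_inverse A" "\<exists>U. core_inverse A = A ** U"
    by (rule conjunct1, rule conjunct2)
qed

section \<open>The core order and the minus order\<close>

text \<open>This eliminates the core inverse \<open>X\<close>. The matrices \<open>X\<close> and
  \<open>A\<^sup>*\<close> are equivalent as left factors, since
  \<open>A\<^sup>* = A\<^sup>* A X\<close> and \<open>X = X X\<^sup>* A\<^sup>*\<close>;
  \<open>X\<close> and \<open>A\<close> are equivalent as right factors, since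
  \<open>X = A U\<close> and \<open>A = X A A\<close>.\<close>

lemma core_le_iff:
  fixes A B :: "complex^'n^'n"
  shows "core_le A B \<longleftrightarrow> A \<in> core_invertible \<and> B \<in> core_invertible \<and>
     conj_transpose A ** A = conj_transpose A ** B \<and> A ** A = B ** A"
proof (cases "A \<in> core_invertible")
  case True
  let ?X = "core_inverse A"
  have AXA: "A ** ?X ** A = A" and herm: "conj_transpose (A ** ?X) = A ** ?X"
    using mp_inverse[of A] by (simp_all add: mult_core_inverse[OF True])
  obtain U where U: "?X = A ** U"
    using core_inverse_right_multiple[OF True] by blast
  \<comment> \<open>As \<open>?X\<close> is a right multiple of \<open>A\<close>, the leading
    \<open>A\<close> can be cancelled here, which yields the second Penrose equation.\<close>
  have "A ** (?X ** A ** ?X) = A ** ?X"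
    by (simp only: matrix_mul_assoc AXA)
  then have "A ** (A ** (U ** A ** ?X)) = A ** (A ** U)"
    by (simp only: U matrix_mul_assoc)
  from core_invertible_left_cancel[OF True this] have XAX: "?X ** A ** ?X = ?X"
    by (simp only: U matrix_mul_assoc)
  have HAX: "conj_transpose A ** (A ** ?X) = conj_transpose A"
    using arg_cong[OF AXA, of conj_transpose] by (simp only: conj_transpose_mult[of "A ** ?X"] herm)
  have "?X ** A = ?X ** B \<longleftrightarrow> conj_transpose A ** A = conj_transpose A ** B"
  proof
    assume XA: "?X ** A = ?X ** B"
    have *: "conj_transpose A ** M = conj_transpose A ** A ** (?X ** M)" for M :: "complex^'n^'n"
    proof -
      have "conj_transpose A ** M = conj_transpose A ** (A ** ?X) ** M"
        by (simp only: HAX)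
      then show ?thesis
        by (simp only: matrix_mul_assoc)
    qed
    have "conj_transpose A ** A = conj_transpose A ** A ** (?X ** A)"
      by (rule *)
    also have "\<dots> = conj_transpose A ** A ** (?X ** B)"
      by (simp only: XA)
    also have "\<dots> = conj_transpose A ** B"
      by (rule *[symmetric])
    finally show "conj_transpose A ** A = conj_transpose A ** B" .
  next
    assume HA: "conj_transpose A ** A = conj_transpose A ** B"
    have *: "?X ** M = ?X ** conj_transpose ?X ** (conj_transpose A ** M)" for M :: "complex^'n^'n"
    proof -
      have "?X ** M = ?X ** (A ** ?X) ** M"
        by (simp only: matrix_mul_assoc XAX)
      also have "A ** ?X = conj_transpose ?X ** conj_transpose A"
        using herm by (simp only: conj_transpose_mult)
      finally show ?thesis
        by (simp only: matrix_mul_assoc)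
    qed
    have "?X ** A = ?X ** conj_transpose ?X ** (conj_transpose A ** A)"
      by (rule *)
    also have "\<dots> = ?X ** conj_transpose ?X ** (conj_transpose A ** B)"
      by (simp only: HA)
    also have "\<dots> = ?X ** B"
      by (rule *[symmetric])
    finally show "?X ** A = ?X ** B" .
  qed
  moreover have "A ** ?X = B ** ?X \<longleftrightarrow> A ** A = B ** A"
  proof
    assume AX: "A ** ?X = B ** ?X"
    have "A ** (?X ** (A ** A)) = A ** A"
      by (simp only: matrix_mul_assoc AXA)
    then have "A ** (A ** (U ** (A ** A))) = A ** (A ** mat 1)"
      by (simp only: U matrix_mul_assoc matrix_mul_rid)
    from core_invertible_left_cancel[OF True this] have A: "?X ** (A ** A) = A"
      by (simp only: U matrix_mul_assoc matrix_mul_rid)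
    have "A ** A = A ** ?X ** (A ** A)"
      by (simp only: matrix_mul_assoc AXA)
    also have "\<dots> = B ** (?X ** (A ** A))"
      unfolding AX by (simp only: matrix_mul_assoc)
    finally show "A ** A = B ** A"
      unfolding A .
  next
    assume "A ** A = B ** A"
    then show "A ** ?X = B ** ?X"
      by (simp only: U matrix_mul_assoc)
  qed
  ultimately show ?thesis
    by (simp add: core_le_def)
qed (simp add: core_le_def)

lemma core_le_refl: "A \<in> core_invertible \<Longrightarrow> core_le A A"
  by (simp add: core_le_def)

text \<open>The inclusion of column spaces that transitivity relies on.\<close>

lemma core_le_right_multiple:
  assumes "core_le A B"
  obtains W where "A = B ** W"
proof -
  have "A \<in> core_invertible" and AA: "A ** A = B ** A"
    using assms by (simp_all add: core_le_iff)
  obtain W where "A = A ** A ** W"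
    using \<open>A \<in> core_invertible\<close> by (rule core_invertible_right)
  also have "\<dots> = B ** (A ** W)"
    by (simp only: AA matrix_mul_assoc)
  finally show thesis
    by (rule that)
qed

text \<open>With \<open>A = B ** W\<close>, multiplying the two relations between \<open>B\<close>
  and \<open>C\<close> by \<open>W\<^sup>*\<close> on the left and by \<open>W\<close> on the right,
  respectively, replaces \<open>B\<close> by \<open>C\<close> in the relations between
  \<open>A\<close> and \<open>B\<close>.\<close>

lemma core_le_trans:
  assumes "core_le A B" "core_le B C"
  shows "core_le A C"
proof -
  obtain W where W: "A = B ** W"
    using assms(1) by (rule core_le_right_multiple)
  have AB: "conj_transpose A ** A = conj_transpose A ** B" "A ** A = B ** A"
    and BC: "conj_transpose B ** B = conj_transpose B ** C" "B ** B = C ** B"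
    using assms by (simp_all add: core_le_iff)
  have "conj_transpose A ** B = conj_transpose W ** (conj_transpose B ** B)"
    unfolding W conj_transpose_mult by (simp only: matrix_mul_assoc)
  also have "\<dots> = conj_transpose A ** C"
    unfolding W BC conj_transpose_mult by (simp only: matrix_mul_assoc)
  finally have "conj_transpose A ** A = conj_transpose A ** C"
    by (simp only: AB(1))
  moreover have "B ** A = C ** A"
    unfolding W by (simp only: matrix_mul_assoc BC)
  with AB(2) have "A ** A = C ** A"
    by (rule trans)
  ultimately show ?thesis
    using assms unfolding core_le_iff by blast
qed

text \<open>The difference is orthogonal to both matrices, hence to itself.\<close>

lemma eq_if_orthogonal_diff:
  assumes "conj_transpose A ** (A - B) = 0" "conj_transpose B ** (A - B) = 0"
  shows "A = B"
proof -
  have "conj_transpose (A - B) ** (A - B) = 0"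
    by (simp only: conj_transpose_diff matrix_sub_rdistrib assms diff_self)
  then have "A - B = 0"
    by (rule conj_transpose_mult_self_eq_zero)
  then show ?thesis
    by simp
qed

lemma core_le_antisym:
  assumes "core_le A B" "core_le B A"
  shows "A = B"
proof (rule eq_if_orthogonal_diff)
  have "conj_transpose A ** A = conj_transpose A ** B" "conj_transpose B ** B = conj_transpose B ** A"
    using assms unfolding core_le_iff by blast+
  then show "conj_transpose A ** (A - B) = 0" "conj_transpose B ** (A - B) = 0"
    by (simp_all only: matrix_sub_ldistrib diff_self)
qed

section \<open>The minus order\<close>

lemma minus_le_refl: "minus_le A A"
  by (simp add: minus_le_def rank_zero)

text \<open>Subadditivity bounds \<open>rank (C - A)\<close> by \<open>rank C - rank A\<close> from
  both sides; the upper bound passes through \<open>B\<close>.\<close>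

lemma minus_le_trans:
  assumes "minus_le A B" "minus_le B C"
  shows "minus_le A C"
proof -
  have "rank (C - A) \<le> rank (C - B) + rank (B - A)" "rank C \<le> rank (C - A) + rank A"
    using rank_plus_le[of "C - B" "B - A"] rank_plus_le[of "C - A" A] by simp_all
  then show ?thesis
    using assms unfolding minus_le_def by linarith
qed

lemma minus_le_antisym:
  assumes "minus_le A B" "minus_le B A"
  shows "A = B"
proof -
  have "rank (B - A) = 0"
    using assms unfolding minus_le_def by linarith
  then have "B - A = 0"
    by (rule rank_eq_0_imp_zero)
  then show ?thesis
    by simp
qed

section \<open>The core-EP decomposition\<close>

text \<open>The ranks of the powers never increase, so they cannot drop at every step. Hence the
  minimum in \<open>mat_index\<close> is attained.\<close>

lemma mat_index_pos:
  assumes "\<not> invertible A"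
  shows "0 < mat_index A"
    and "rank (mat_pow A (Suc (mat_index A))) = rank (mat_pow A (mat_index A))"
proof -
  have "\<exists>k>0. rank (mat_pow A (k + 1)) = rank (mat_pow A k)"
  proof (rule ccontr)
    assume "\<not> ?thesis"
    moreover have "rank (mat_pow A (k + 1)) \<le> rank (mat_pow A k)" for k
      by (simp add: mat_pow_Suc rank_matrix_mult_le_right)
    ultimately have less: "rank (mat_pow A (k + 1)) < rank (mat_pow A k)" if "k > 0" for k
      using that by (meson le_neq_implies_less)
    \<comment> \<open>The count starts at exponent 1, because strict descent was assumed for
      positive exponents only.\<close>
    have "rank (mat_pow A (Suc k)) + k \<le> rank (mat_pow A 1)" for k
    proof (induction k)
      case (Suc k)
      with less[of "Suc k"] show ?case
        by simp
    qed simp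
    from this[of "Suc (rank (mat_pow A 1))"] show False
      by simp
  qed
  from LeastI_ex[OF this] show "0 < mat_index A"
    "rank (mat_pow A (Suc (mat_index A))) = rank (mat_pow A (mat_index A))"
    using assms by (simp_all add: mat_index_def)
qed

lemma core_EP_decomp_exists: "\<exists>A1 A2. core_EP_decomp A A1 A2"
proof (cases "invertible A")
  case True
  then obtain B where "B ** A = mat 1"
    unfolding invertible_def by blast
  then have "A = B ** (A ** A)"
    by (simp add: matrix_mul_assoc)
  then have "A \<in> core_invertible"
    unfolding core_invertible_left_iff by (rule exI)
  then have "core_EP_decomp A A 0"
    using True by (simp add: core_EP_decomp_def mat_index_def)
  then show ?thesis
    by blast
next
  case False
  define k where "k = mat_index A"
  define K where "K = mat_pow A k"
  have k: "0 < k" and rank_K: "rank (A ** K) = rank K"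
    using mat_index_pos[OF False] by (simp_all add: k_def K_def mat_pow_Suc)
  obtain Z where Z: "K = Z ** (A ** K)"
    using rank_K unfolding rank_matrix_mult_eq_right_iff ..
  have AK: "A ** K = K ** A"
    unfolding K_def by (rule trans[OF mat_pow_Suc[symmetric] mat_pow_Suc_right])
  obtain Q where Q: "K ** Q ** K = K" "conj_transpose (K ** Q) = K ** Q"
    by (rule hermitian_inner_inverse_exists)
  define P where "P = K ** Q"
  define A2 where "A2 = A - P ** A"
  have PK: "P ** K = K" and P: "conj_transpose P = P"
    using Q by (simp_all only: P_def)
  have PP: "P ** P = P"
    using PK by (simp add: P_def matrix_mul_assoc)
  \<comment> \<open>\<open>A\<close> commutes with its power \<open>K\<close>, so it maps the column
    space of \<open>K\<close>, which is the range of \<open>P\<close>, into itself.\<close>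
  have "P ** A ** P = P ** (A ** K) ** Q"
    by (simp only: P_def matrix_mul_assoc)
  also have "\<dots> = P ** K ** A ** Q"
    by (simp only: AK matrix_mul_assoc)
  also have "\<dots> = A ** K ** Q"
    by (simp only: PK AK)
  also have "\<dots> = A ** P"
    by (simp only: P_def matrix_mul_assoc)
  finally have PAP: "P ** A ** P = A ** P" .
  \<comment> \<open>On that invariant column space \<open>Z\<close> is a left inverse of
    \<open>A\<close>; this makes \<open>P ** A\<close> core-invertible.\<close>
  have "Z ** A ** P = Z ** (A ** K) ** Q"
    by (simp only: P_def matrix_mul_assoc)
  then have ZAP: "Z ** A ** P = P"
    by (simp only: Z[symmetric] P_def)
  have "P ** A = Z ** (P ** A ** (P ** A))"
    by (simp only: PAP ZAP matrix_mul_assoc)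
  then have core: "P ** A \<in> core_invertible"
    unfolding core_invertible_left_iff by (rule exI)
  have "P ** A2 = 0"
    by (simp only: A2_def matrix_sub_ldistrib matrix_mul_assoc PP diff_self)
  then have orth: "conj_transpose (P ** A) ** A2 = 0"
    by (simp only: conj_transpose_mult P times0_right flip: matrix_mul_assoc)
  have A2P: "A2 ** P = 0"
    by (simp only: A2_def matrix_sub_rdistrib PAP diff_self)
  then have zero: "A2 ** (P ** A) = 0"
    by (simp only: matrix_mul_assoc times0_left)
  \<comment> \<open>Exponent 0 is left out, since there the formula would say \<open>P = 0\<close>.
    At exponent \<open>k\<close>, which is positive because \<open>A\<close> is singular,
    \<open>P\<close> fixes the power and the difference vanishes.\<close>
  have pow: "mat_pow A2 (Suc j) = mat_pow A (Suc j) - P ** mat_pow A (Suc j)" for j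
  proof (induction j)
    case 0
    show ?case
      by (simp add: mat_pow_Suc A2_def)
  next
    case (Suc j)
    let ?B = "mat_pow A (Suc j)"
    have "A2 ** (P ** ?B) = 0"
      by (simp only: A2P matrix_mul_assoc times0_left)
    moreover have "mat_pow A2 (Suc (Suc j)) = A2 ** ?B - A2 ** (P ** ?B)"
      using Suc by (simp add: mat_pow_Suc[of A2 "Suc j"] matrix_sub_ldistrib)
    ultimately show ?case
      by (simp add: A2_def matrix_sub_rdistrib mat_pow_Suc[of A "Suc j"] matrix_mul_assoc)
  qed
  have "mat_pow A2 k = 0"
    using pow[of "k - 1"] k PK by (simp add: K_def)
  then have "core_EP_decomp A (P ** A) A2"
    using core orth zero k by (simp add: core_EP_decomp_def A2_def k_def)
  then show ?thesis
    by blast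
qed

section \<open>Uniqueness of the core-EP decomposition\<close>

lemma mat_pow_add_mult:
  assumes "A2 ** A1 = 0"
  shows "mat_pow (A1 + A2) j ** A1 = mat_pow A1 (Suc j)"
proof (induction j)
  case (Suc j)
  have "mat_pow (A1 + A2) (Suc j) ** A1 = (A1 + A2) ** (mat_pow (A1 + A2) j ** A1)"
    by (simp only: mat_pow_Suc matrix_mul_assoc)
  also have "\<dots> = A1 ** mat_pow A1 (Suc j) + A2 ** A1 ** mat_pow A1 j"
    unfolding Suc matrix_add_rdistrib by (simp only: mat_pow_Suc matrix_mul_assoc)
  also have "\<dots> = mat_pow A1 (Suc (Suc j))"
    by (simp add: assms mat_pow_Suc)
  finally show ?case .
qed (simp add: mat_pow_Suc)

text \<open>Every word containing \<open>A2 ** A1\<close> vanishes, so the surviving words of the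
  expansion either begin with \<open>A1\<close> or are the pure power of \<open>A2\<close>. When
  that power is zero, the column space of the whole power lies in that of \<open>A1\<close>.\<close>

lemma mat_pow_add_eq:
  assumes "A2 ** A1 = 0"
  shows "\<exists>Y. mat_pow (A1 + A2) j = A1 ** Y + mat_pow A2 j"
proof (induction j)
  case 0
  show ?case
    by (rule exI[of _ 0]) simp
next
  case (Suc j)
  then obtain Y where Y: "mat_pow (A1 + A2) j = A1 ** Y + mat_pow A2 j"
    by blast
  have "mat_pow (A1 + A2) (Suc j) = A1 ** (A1 ** Y + mat_pow A2 j) + (A2 ** A1 ** Y + A2 ** mat_pow A2 j)"
    by (simp only: mat_pow_Suc Y matrix_add_rdistrib matrix_add_ldistrib matrix_mul_assoc
        add.assoc add.left_commute)
  then have "mat_pow (A1 + A2) (Suc j) = A1 ** (A1 ** Y + mat_pow A2 j) + mat_pow A2 (Suc j)"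
    by (simp add: assms mat_pow_Suc)
  then show ?case
    by (rule exI)
qed

text \<open>Iterating \<open>A = A ** A ** W\<close> puts \<open>A\<close> into the column space of
  each of its positive powers.\<close>

lemma core_invertible_pow:
  assumes "A \<in> core_invertible"
  shows "\<exists>V. A = mat_pow A (Suc j) ** V"
proof (induction j)
  case 0
  show ?case
    by (rule exI[of _ "mat 1"]) (simp add: mat_pow_Suc)
next
  case (Suc j)
  then obtain V where V: "A = mat_pow A (Suc j) ** V" ..
  obtain W where "A = A ** A ** W"
    using assms by (rule core_invertible_right)
  also have "\<dots> = A ** (mat_pow A (Suc j) ** V) ** W"
    by (simp only: V[symmetric])
  also have "\<dots> = mat_pow A (Suc (Suc j)) ** (V ** W)"
    by (simp only: mat_pow_Suc[of A "Suc j"] matrix_mul_assoc)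
  finally show ?case
    by (rule exI)
qed

text \<open>The column space of \<open>A1\<close> lies in that of \<open>A\<^sup>k\<close>, which
  lies in that of \<open>B1\<close>. So \<open>A1\<close> is orthogonal to \<open>B2\<close> as well
  as to \<open>A2\<close>, and \<open>A1 - B1 = B2 - A2\<close>.\<close>

lemma core_EP_decomp_orthogonal_diff:
  assumes "core_EP_decomp A A1 A2" "core_EP_decomp A B1 B2"
  shows "conj_transpose A1 ** (A1 - B1) = 0"
proof (cases "mat_index A = 0")
  case True
  then have "A2 = 0" "B2 = 0" "A = A1 + A2" "A = B1 + B2"
    using assms unfolding core_EP_decomp_def if_P[OF True] by blast+
  then show ?thesis
    by simp
next
  case False
  define k where "k = mat_index A"
  have A: "A = A1 + A2" "A1 \<in> core_invertible" "conj_transpose A1 ** A2 = 0" "A2 ** A1 = 0"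
    using assms(1) unfolding core_EP_decomp_def by blast+
  have B: "A = B1 + B2" "mat_pow B2 k = 0" "conj_transpose B1 ** B2 = 0" "B2 ** B1 = 0"
    using assms(2) unfolding core_EP_decomp_def if_not_P[OF False] k_def by blast+
  obtain Y where Y: "mat_pow A k = B1 ** Y"
    using mat_pow_add_eq[OF B(4), of k] unfolding B(1)[symmetric] B(2) add_0_right ..
  \<comment> \<open>The exponent exceeds the index by one because
    \<open>A1\<^sup>k\<^sup>+\<^sup>1\<close> is the product of \<open>A\<^sup>k\<close> and
    \<open>A1\<close>.\<close>
  obtain V where "A1 = mat_pow A1 (Suc k) ** V"
    using core_invertible_pow[OF A(2)] ..
  also have "mat_pow A1 (Suc k) = mat_pow A k ** A1"
    using mat_pow_add_mult[OF A(4), of k] unfolding A(1)[symmetric] ..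
  also have "mat_pow A k ** A1 ** V = B1 ** (Y ** A1 ** V)"
    by (simp only: Y matrix_mul_assoc)
  finally have A1: "A1 = B1 ** (Y ** A1 ** V)" .
  have "conj_transpose A1 ** B2 = conj_transpose (B1 ** (Y ** A1 ** V)) ** B2"
    by (simp only: A1[symmetric])
  also have "\<dots> = conj_transpose (Y ** A1 ** V) ** (conj_transpose B1 ** B2)"
    by (simp only: conj_transpose_mult matrix_mul_assoc)
  also have "\<dots> = 0"
    by (simp only: B times0_right)
  finally have B2: "conj_transpose A1 ** B2 = 0" .
  have "A1 + A2 = B1 + B2"
    using A(1) B(1) by (rule subst)
  then have "A1 - B1 = B2 - A2"
    by (simp add: algebra_simps)
  then show ?thesis
    by (simp only: matrix_sub_ldistrib A B2 diff_self)
qed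

lemma core_EP_decomp_unique:
  assumes "core_EP_decomp A A1 A2" "core_EP_decomp A B1 B2"
  shows "A1 = B1" "A2 = B2"
proof -
  have "conj_transpose B1 ** (B1 - A1) = 0"
    by (rule core_EP_decomp_orthogonal_diff[OF assms(2,1)])
  then have "conj_transpose B1 ** (A1 - B1) = 0"
    by (simp add: matrix_sub_ldistrib)
  with core_EP_decomp_orthogonal_diff[OF assms] show "A1 = B1"
    by (rule eq_if_orthogonal_diff)
  moreover have "A = A1 + A2" "A = B1 + B2"
    using assms unfolding core_EP_decomp_def by blast+
  ultimately show "A2 = B2"
    by simp
qed

section \<open>The core-minus order\<close>

lemma core_minus_le_refl: "core_minus_le A A"
proof -
  obtain A1 A2 where A: "core_EP_decomp A A1 A2"
    using core_EP_decomp_exists by blast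
  then have "A1 \<in> core_invertible"
    unfolding core_EP_decomp_def by blast
  then show ?thesis
    unfolding core_minus_le_def using A core_le_refl minus_le_refl by blast
qed

text \<open>The two hypotheses may name different decompositions of \<open>B\<close>; uniqueness
  identifies them, and the two orders then compose componentwise.\<close>

lemma core_minus_le_trans:
  assumes "core_minus_le A B" "core_minus_le B C"
  shows "core_minus_le A C"
proof -
  obtain A1 A2 B1 B2 where A: "core_EP_decomp A A1 A2" and B: "core_EP_decomp B B1 B2"
    and AB: "core_le A1 B1" "minus_le A2 B2"
    using assms(1) unfolding core_minus_le_def by blast
  obtain B1' B2' C1 C2 where B': "core_EP_decomp B B1' B2'" and C: "core_EP_decomp C C1 C2"
    and BC: "core_le B1' C1" "minus_le B2' C2"
    using assms(2) unfolding core_minus_le_def by blast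
  have "core_le A1 C1" "minus_le A2 C2"
    using AB BC core_le_trans minus_le_trans unfolding core_EP_decomp_unique[OF B B'] by blast+
  then show ?thesis
    unfolding core_minus_le_def using A C by blast
qed

lemma core_minus_le_antisym:
  assumes "core_minus_le A B" "core_minus_le B A"
  shows "A = B"
proof -
  obtain A1 A2 B1 B2 where A: "core_EP_decomp A A1 A2" and B: "core_EP_decomp B B1 B2"
    and AB: "core_le A1 B1" "minus_le A2 B2"
    using assms(1) unfolding core_minus_le_def by blast
  obtain B1' B2' A1' A2' where B': "core_EP_decomp B B1' B2'" and A': "core_EP_decomp A A1' A2'"
    and BA: "core_le B1' A1'" "minus_le B2' A2'"
    using assms(2) unfolding core_minus_le_def by blast
  have "A1' = B1'" "A2' = B2'"
    using AB BA core_le_antisym minus_le_antisym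
    unfolding core_EP_decomp_unique[OF A A'] core_EP_decomp_unique[OF B B'] by blast+
  moreover have "A = A1' + A2'" "B = B1' + B2'"
    using A' B' unfolding core_EP_decomp_def by blast+
  ultimately show ?thesis
    by simp
qed

theorem theorem5p1:
  shows "partial_order_on (UNIV :: (complex^'n^'n) set) {(A, B). core_minus_le A B}"
  unfolding partial_order_on_def preorder_on_def
  by (auto simp: core_minus_le_refl intro!: refl_onI transI antisymI
      intro: core_minus_le_trans core_minus_le_antisym)

end
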